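(* Let $n\ge 2$ and let $V$ be a finite-dimensional calibrated $A_n$-representation. Then the eigenvalues of $Y_j$ on $V$ are in $\mathbb{Z}$ for all $j=2,\dots,n$, and the entries of the $Y_j$ as diagonal matrices (in a basis of $V$ with respect to which all $Y_1,\dots,Y_n$ are diagonal) satisfy $(Y_j)_{\ell,\ell}\ne (Y_{j+1})_{\ell,\ell}$ for all $\ell=1,\dots,\dim V$ and each $j=1,\dots,n-1$.
   Context: The periplectic Brauer algebra $A_n$ is the unital associative $\mathbb{C}$-algebra with generators $s_i,e_i$ ($1\le i\le n-1$) and relations (for all indices for which the expressions make sense): $s_i^2=1$; $s_is_j=s_js_i$, $s_ie_j=e_js_i$, $e_ie_j=e_je_i$ if $|i-j|>1$; $s_is_{i+1}s_i=s_{i+1}s_is_{i+1}$; $e_{i+1}e_ie_{i+1}=-e_{i+1}$; $e_ie_{i+1}e_i=-e_i$; $e_is_i=e_i$; $s_ie_i=-e_i$; $s_ie_{i+1}e_i=s_{i+1}e_i$; $s_{i+1}e_ie_{i+1}=-s_ie_{i+1}$; $e_{i+1}e_is_{i+1}=e_{i+1}s_i$; $e_ie_{i+1}s_i=-e_is_{i+1}$; $e_i^2=0$. The Jucys--Murphy elements of $A_n$ are $Y_1:=0$, $Y_{j+1}:=s_jY_js_j+s_j+e_j$ for $1\le j\le n-1$. It is known that they commute with each other, and that they also satisfy $e_iY_j=Y_je_i$, $s_iY_j=Y_js_i$ for $j\ne i,i+1$, $e_i(Y_i-Y_{i+1})=-e_i$ and $(Y_i-Y_{i+1})e_i=e_i$.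 A representation $V$ of $A_n$ is called calibrated if $V$ has a basis with respect to which $Y_j$ acts by a diagonal matrix for all $j=1,\dots,n$ simultaneously. All representations are finite-dimensional over $\mathbb{C}$. *)

theory Defs
  imports Complex_Main "HOL-Library.Poly_Mapping" "HOL-Algebra.QuotRing" "HOL-Algebra.Module"
begin

datatype generator = Gen_s nat | Gen_e nat

fun index :: "generator \<Rightarrow> nat" where
  "index (Gen_s i) = i"
| "index (Gen_e i) = i"

text \<open>Words form the free monoid, written additively because the convolution product on
  \<^typ>\<open>'a \<Rightarrow>\<^sub>0 'b\<close> is defined over an additive monoid \<open>'a\<close> (not necessarily commutative).\<close>

datatype word = Word (letters: "generator list")

instantiation word :: monoid_add
begin

definition zero_word :: word where
  "zero_word = Word []"

definition plus_word :: "word \<Rightarrow> word \<Rightarrow> word" where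
  "plus_word u v = Word (letters u @ letters v)"

instance
  by standard (simp_all add: zero_word_def plus_word_def)

end

type_synonym nc_poly = "word \<Rightarrow>\<^sub>0 complex"

definition s_gen :: "nat \<Rightarrow> nc_poly" where
  "s_gen i = Poly_Mapping.single (Word [Gen_s i]) 1"

definition e_gen :: "nat \<Rightarrow> nc_poly" where
  "e_gen i = Poly_Mapping.single (Word [Gen_e i]) 1"

text \<open>The record \<^typ>\<open>('a, 'b) module\<close> is used for \<open>'a\<close>-algebras: it carries the ring
  operations together with a scalar multiplication.\<close>

definition free_algebra :: "nat \<Rightarrow> (complex, nc_poly) module" where
  "free_algebra n =
     \<lparr>carrier = {p. \<forall>w \<in> Poly_Mapping.keys p. \<forall>g \<in> set (letters w). 1 \<le> index g \<and> index g \<le> n - 1},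
      monoid.mult = (*), one = 1, zero = 0, add = (+),
      smult = (\<lambda>c p. Poly_Mapping.map ((*) c) p)\<rparr>"

inductive defining_relation :: "nat \<Rightarrow> nc_poly \<Rightarrow> nc_poly \<Rightarrow> bool" for n :: nat where
  s_square: "1 \<le> i \<Longrightarrow> i \<le> n - 1 \<Longrightarrow>
    defining_relation n (s_gen i * s_gen i) 1"
| ss_commute: "1 \<le> i \<Longrightarrow> i \<le> n - 1 \<Longrightarrow> 1 \<le> j \<Longrightarrow> j \<le> n - 1 \<Longrightarrow> \<bar>int i - int j\<bar> > 1 \<Longrightarrow>
    defining_relation n (s_gen i * s_gen j) (s_gen j * s_gen i)"
| se_commute: "1 \<le> i \<Longrightarrow> i \<le> n - 1 \<Longrightarrow> 1 \<le> j \<Longrightarrow> j \<le> n - 1 \<Longrightarrow> \<bar>int i - int j\<bar> > 1 \<Longrightarrow>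
    defining_relation n (s_gen i * e_gen j) (e_gen j * s_gen i)"
| ee_commute: "1 \<le> i \<Longrightarrow> i \<le> n - 1 \<Longrightarrow> 1 \<le> j \<Longrightarrow> j \<le> n - 1 \<Longrightarrow> \<bar>int i - int j\<bar> > 1 \<Longrightarrow>
    defining_relation n (e_gen i * e_gen j) (e_gen j * e_gen i)"
| braid: "1 \<le> i \<Longrightarrow> i + 1 \<le> n - 1 \<Longrightarrow>
    defining_relation n (s_gen i * s_gen (i+1) * s_gen i) (s_gen (i+1) * s_gen i * s_gen (i+1))"
| eee_up: "1 \<le> i \<Longrightarrow> i + 1 \<le> n - 1 \<Longrightarrow>
    defining_relation n (e_gen (i+1) * e_gen i * e_gen (i+1)) (- e_gen (i+1))"
| eee_down: "1 \<le> i \<Longrightarrow> i + 1 \<le> n - 1 \<Longrightarrow>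
    defining_relation n (e_gen i * e_gen (i+1) * e_gen i) (- e_gen i)"
| es: "1 \<le> i \<Longrightarrow> i \<le> n - 1 \<Longrightarrow>
    defining_relation n (e_gen i * s_gen i) (e_gen i)"
| se: "1 \<le> i \<Longrightarrow> i \<le> n - 1 \<Longrightarrow>
    defining_relation n (s_gen i * e_gen i) (- e_gen i)"
| see_up: "1 \<le> i \<Longrightarrow> i + 1 \<le> n - 1 \<Longrightarrow>
    defining_relation n (s_gen i * e_gen (i+1) * e_gen i) (s_gen (i+1) * e_gen i)"
| see_down: "1 \<le> i \<Longrightarrow> i + 1 \<le> n - 1 \<Longrightarrow>
    defining_relation n (s_gen (i+1) * e_gen i * e_gen (i+1)) (- (s_gen i * e_gen (i+1)))"
| ees_up: "1 \<le> i \<Longrightarrow> i + 1 \<le> n - 1 \<Longrightarrow>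
    defining_relation n (e_gen (i+1) * e_gen i * s_gen (i+1)) (e_gen (i+1) * s_gen i)"
| ees_down: "1 \<le> i \<Longrightarrow> i + 1 \<le> n - 1 \<Longrightarrow>
    defining_relation n (e_gen i * e_gen (i+1) * s_gen i) (- (e_gen i * s_gen (i+1)))"
| e_square: "1 \<le> i \<Longrightarrow> i \<le> n - 1 \<Longrightarrow>
    defining_relation n (e_gen i * e_gen i) 0"

definition relation_ideal :: "nat \<Rightarrow> nc_poly set" where
  "relation_ideal n = Idl\<^bsub>free_algebra n\<^esub> {p - q | p q. defining_relation n p q}"

definition quotient_class :: "nat \<Rightarrow> nc_poly \<Rightarrow> nc_poly set" where
  "quotient_class n p = relation_ideal n +>\<^bsub>free_algebra n\<^esub> p"

text \<open>The scalar multiplication on cosets is induced in the same way as the product of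
  \<^const>\<open>FactRing\<close>.\<close>

definition periplectic_brauer :: "nat \<Rightarrow> (complex, nc_poly set) module" where
  "periplectic_brauer n = ring.extend (free_algebra n Quot relation_ideal n)
     \<lparr>smult = (\<lambda>c X. \<Union>p\<in>X. quotient_class n (c \<odot>\<^bsub>free_algebra n\<^esub> p))\<rparr>"

definition s_elem :: "nat \<Rightarrow> nat \<Rightarrow> nc_poly set" where
  "s_elem n i = quotient_class n (s_gen i)"

definition e_elem :: "nat \<Rightarrow> nat \<Rightarrow> nc_poly set" where
  "e_elem n i = quotient_class n (e_gen i)"

text \<open>\<^term>\<open>jucys_murphy n j\<close> is only meaningful for \<open>1 \<le> j \<le> n\<close>; the value at \<open>0\<close> is a dummy.\<close>

fun jucys_murphy :: "nat \<Rightarrow> nat \<Rightarrow> nc_poly set" where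
  "jucys_murphy n 0 = \<zero>\<^bsub>periplectic_brauer n\<^esub>"
| "jucys_murphy n (Suc 0) = \<zero>\<^bsub>periplectic_brauer n\<^esub>"
| "jucys_murphy n (Suc (Suc k)) =
     (s_elem n (Suc k) \<otimes>\<^bsub>periplectic_brauer n\<^esub> jucys_murphy n (Suc k)
        \<otimes>\<^bsub>periplectic_brauer n\<^esub> s_elem n (Suc k))
     \<oplus>\<^bsub>periplectic_brauer n\<^esub> s_elem n (Suc k) \<oplus>\<^bsub>periplectic_brauer n\<^esub> e_elem n (Suc k)"

definition algebra_hom :: "('k, 'a) module \<Rightarrow> ('k, 'b) module \<Rightarrow> ('a \<Rightarrow> 'b) set" where
  "algebra_hom A B = {h \<in> ring_hom A B.
     \<forall>c. \<forall>x \<in> carrier A. h (c \<odot>\<^bsub>A\<^esub> x) = c \<odot>\<^bsub>B\<^esub> h x}"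

definition End_algebra ::
    "('k::field \<Rightarrow> 'v::ab_group_add \<Rightarrow> 'v) \<Rightarrow> ('k, 'v \<Rightarrow> 'v) module" where
  "End_algebra scale =
     \<lparr>carrier = {f. Vector_Spaces.linear scale scale f},
      monoid.mult = (\<circ>), one = id, zero = (\<lambda>v. 0), add = (\<lambda>f g v. f v + g v),
      smult = (\<lambda>c f v. scale c (f v))\<rparr>"

definition representation_of ::
    "nat \<Rightarrow> (complex \<Rightarrow> 'v::ab_group_add \<Rightarrow> 'v) \<Rightarrow> (nc_poly set \<Rightarrow> 'v \<Rightarrow> 'v) \<Rightarrow> bool" where
  "representation_of n scale \<rho> \<longleftrightarrow>
     \<rho> \<in> algebra_hom (periplectic_brauer n) (End_algebra scale)"

definition eigenvalue ::
    "('k::field \<Rightarrow> 'v::ab_group_add \<Rightarrow> 'v) \<Rightarrow> ('v \<Rightarrow> 'v) \<Rightarrow> 'k \<Rightarrow> bool" where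
  "eigenvalue scale f c \<longleftrightarrow> (\<exists>v. v \<noteq> 0 \<and> f v = scale c v)"

abbreviation vdim :: "('k::field \<Rightarrow> 'v::ab_group_add \<Rightarrow> 'v) \<Rightarrow> nat" where
  "vdim scale \<equiv> vector_space.dim scale UNIV"

text \<open>Bases are indexed by \<open>1, \<dots>, dim V\<close>; the values of \<open>b\<close> outside this range are irrelevant.\<close>

definition ordered_basis ::
    "('k::field \<Rightarrow> 'v::ab_group_add \<Rightarrow> 'v) \<Rightarrow> (nat \<Rightarrow> 'v) \<Rightarrow> bool" where
  "ordered_basis scale b \<longleftrightarrow> inj_on b {1..vdim scale}
     \<and> \<not> module.dependent scale (b ` {1..vdim scale})
     \<and> module.span scale (b ` {1..vdim scale}) = UNIV"

definition matrix_entry ::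
    "('k::field \<Rightarrow> 'v::ab_group_add \<Rightarrow> 'v) \<Rightarrow> (nat \<Rightarrow> 'v) \<Rightarrow> ('v \<Rightarrow> 'v) \<Rightarrow> nat \<Rightarrow> nat \<Rightarrow> 'k" where
  "matrix_entry scale b f k l = module.representation scale (b ` {1..vdim scale}) (f (b l)) (b k)"

definition diagonal_wrt ::
    "('k::field \<Rightarrow> 'v::ab_group_add \<Rightarrow> 'v) \<Rightarrow> (nat \<Rightarrow> 'v) \<Rightarrow> ('v \<Rightarrow> 'v) \<Rightarrow> bool" where
  "diagonal_wrt scale b f \<longleftrightarrow>
     (\<forall>k\<in>{1..vdim scale}. \<forall>l\<in>{1..vdim scale}. k \<noteq> l \<longrightarrow> matrix_entry scale b f k l = 0)"

definition diagonalizing_basis ::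
    "nat \<Rightarrow> (complex \<Rightarrow> 'v::ab_group_add \<Rightarrow> 'v) \<Rightarrow> (nc_poly set \<Rightarrow> 'v \<Rightarrow> 'v) \<Rightarrow> (nat \<Rightarrow> 'v) \<Rightarrow> bool" where
  "diagonalizing_basis n scale \<rho> b \<longleftrightarrow> ordered_basis scale b
     \<and> (\<forall>j\<in>{1..n}. diagonal_wrt scale b (\<rho> (jucys_murphy n j)))"

definition calibrated ::
    "nat \<Rightarrow> (complex \<Rightarrow> 'v::ab_group_add \<Rightarrow> 'v) \<Rightarrow> (nc_poly set \<Rightarrow> 'v \<Rightarrow> 'v) \<Rightarrow> bool" where
  "calibrated n scale \<rho> \<longleftrightarrow> (\<exists>b. diagonalizing_basis n scale \<rho> b)"

lemma carrier_free_algebra: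
  "carrier (free_algebra n) =
     {p. \<forall>w \<in> Poly_Mapping.keys p. \<forall>g \<in> set (letters w). 1 \<le> index g \<and> index g \<le> n - 1}"
  by (simp add: free_algebra_def)

lemma free_algebra_simps [simp]:
  "monoid.mult (free_algebra n) = (*)" "one (free_algebra n) = 1"
  "zero (free_algebra n) = 0" "add (free_algebra n) = (+)"
  "smult (free_algebra n) = (\<lambda>c p. Poly_Mapping.map ((*) c) p)"
  by (simp_all add: free_algebra_def)

lemma free_algebra_closed:
  assumes "p \<in> carrier (free_algebra n)" "q \<in> carrier (free_algebra n)"
  shows "p + q \<in> carrier (free_algebra n)" "p * q \<in> carrier (free_algebra n)"
    "- p \<in> carrier (free_algebra n)" "p - q \<in> carrier (free_algebra n)"
proof -
  show "p + q \<in> carrier (free_algebra n)"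
    using assms Poly_Mapping.keys_add[of p q] unfolding carrier_free_algebra by blast
  show "p * q \<in> carrier (free_algebra n)"
    using assms Poly_Mapping.keys_mult[of p q]
    by (fastforce simp: carrier_free_algebra plus_word_def)
  show "- p \<in> carrier (free_algebra n)"
    using assms by (simp add: carrier_free_algebra)
  show "p - q \<in> carrier (free_algebra n)"
    using assms Poly_Mapping.keys_diff[of p q] unfolding carrier_free_algebra by blast
qed

lemma ring_free_algebra: "ring (free_algebra n)"
proof (rule ringI)
  show "abelian_group (free_algebra n)"
  proof (rule abelian_groupI)
    fix p assume p: "p \<in> carrier (free_algebra n)"
    show "\<exists>y\<in>carrier (free_algebra n). y \<oplus>\<^bsub>free_algebra n\<^esub> p = \<zero>\<^bsub>free_algebra n\<^esub>"
      using free_algebra_closed(3)[OF p p] by (intro bexI[of _ "- p"]) auto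
  qed (auto simp: free_algebra_closed add_ac, simp add: carrier_free_algebra)
  show "Group.monoid (free_algebra n)"
    by (rule monoidI) (auto simp: free_algebra_closed mult.assoc,
        simp add: carrier_free_algebra zero_word_def)
qed (auto simp: algebra_simps)

lemma gens_closed:
  assumes "1 \<le> i" "i \<le> n - 1"
  shows "s_gen i \<in> carrier (free_algebra n)" "e_gen i \<in> carrier (free_algebra n)"
  using assms by (auto simp: carrier_free_algebra s_gen_def e_gen_def)

lemma free_algebra_zero_one:
  "0 \<in> carrier (free_algebra n)" "1 \<in> carrier (free_algebra n)"
  by (simp_all add: carrier_free_algebra zero_word_def)

lemma defining_relation_closed:
  assumes "defining_relation n p q"
  shows "p \<in> carrier (free_algebra n)" "q \<in> carrier (free_algebra n)"
  using assms
  by (induction rule: defining_relation.induct)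
     (auto intro!: free_algebra_closed gens_closed free_algebra_zero_one)

lemma ideal_relation_ideal: "ideal (relation_ideal n) (free_algebra n)"
  unfolding relation_ideal_def
  by (rule ring.genideal_ideal[OF ring_free_algebra])
     (auto intro!: free_algebra_closed dest: defining_relation_closed)

lemma quotient_class_relation:
  assumes "defining_relation n p q"
  shows "quotient_class n p = quotient_class n q"
proof -
  interpret ring "free_algebra n" by (rule ring_free_algebra)
  interpret ideal "relation_ideal n" "free_algebra n" by (rule ideal_relation_ideal)
  have pq: "p \<in> carrier (free_algebra n)" "q \<in> carrier (free_algebra n)"
    using assms by (auto dest: defining_relation_closed)
  have neg: "\<ominus>\<^bsub>free_algebra n\<^esub> q = - q"
    by (rule minus_equality) (use pq free_algebra_closed(3) in auto)
  have "p - q \<in> relation_ideal n"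
    unfolding relation_ideal_def
    by (rule subsetD[OF genideal_self])
       (use assms in \<open>auto intro!: free_algebra_closed dest: defining_relation_closed\<close>)
  hence "p \<ominus>\<^bsub>free_algebra n\<^esub> q \<in> relation_ideal n"
    by (simp add: a_minus_def neg)
  thus ?thesis
    using quotient_eq_iff_same_a_r_cos[OF ideal_relation_ideal pq] by (simp add: quotient_class_def)
qed

lemma ring_periplectic_brauer: "ring (periplectic_brauer n)"
proof -
  let ?Q = "free_algebra n Quot relation_ideal n"
  interpret Q: ring ?Q
    by (rule ideal.quotient_is_ring[OF ideal_relation_ideal])
  have eq: "carrier (periplectic_brauer n) = carrier ?Q"
    "monoid.mult (periplectic_brauer n) = monoid.mult ?Q" "one (periplectic_brauer n) = one ?Q"
    "zero (periplectic_brauer n) = zero ?Q" "add (periplectic_brauer n) = add ?Q"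
    by (simp_all add: periplectic_brauer_def ring.defs)
  show ?thesis
  proof (rule ringI)
    show "abelian_group (periplectic_brauer n)"
    proof (rule abelian_groupI, unfold eq)
      fix x assume "x \<in> carrier ?Q"
      thus "\<exists>y\<in>carrier ?Q. y \<oplus>\<^bsub>?Q\<^esub> x = \<zero>\<^bsub>?Q\<^esub>"
        by (intro bexI[of _ "\<ominus>\<^bsub>?Q\<^esub> x"]) (simp_all add: Q.l_neg)
    qed (simp_all add: Q.a_ac)
    show "Group.monoid (periplectic_brauer n)"
      by (rule monoidI, unfold eq) (simp_all add: Q.m_assoc)
  qed (unfold eq, simp_all add: Q.l_distr Q.r_distr)
qed

lemma scale_conv_mult:
  "Poly_Mapping.map ((*) c) p = Poly_Mapping.single 0 c * (p :: nc_poly)"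
  by (rule mult_map_scale_conv_mult)

lemma periplectic_brauer_smult:
  assumes p: "p \<in> carrier (free_algebra n)"
  shows "c \<odot>\<^bsub>periplectic_brauer n\<^esub> quotient_class n p
           = quotient_class n (c \<odot>\<^bsub>free_algebra n\<^esub> p)"
proof -
  interpret ring "free_algebra n" by (rule ring_free_algebra)
  interpret I: ideal "relation_ideal n" "free_algebra n" by (rule ideal_relation_ideal)
  have c: "Poly_Mapping.single 0 c \<in> carrier (free_algebra n)"
    by (simp add: carrier_free_algebra zero_word_def)
  have same: "quotient_class n (c \<odot>\<^bsub>free_algebra n\<^esub> x) = quotient_class n (c \<odot>\<^bsub>free_algebra n\<^esub> p)"
    if cl: "x \<in> quotient_class n p" for x
  proof -
    obtain i where i: "i \<in> relation_ideal n" and x: "x = i + p"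
      using cl by (auto simp: quotient_class_def a_r_coset_def')
    have "Poly_Mapping.single 0 c * i \<in> relation_ideal n"
      using I.I_l_closed[OF i c] by simp
    hence "Poly_Mapping.single 0 c * x \<in> quotient_class n (Poly_Mapping.single 0 c * p)"
      by (auto simp: quotient_class_def a_r_coset_def' x distrib_left)
    thus ?thesis
      using I.a_repr_independence'[of "Poly_Mapping.single 0 c * x" "Poly_Mapping.single 0 c * p"]
        free_algebra_closed(2)[OF c p]
      by (simp add: quotient_class_def scale_conv_mult)
  qed
  have self: "p \<in> quotient_class n p"
    unfolding quotient_class_def by (rule I.a_rcos_self[OF p])
  have "(\<Union>x\<in>quotient_class n p. quotient_class n (c \<odot>\<^bsub>free_algebra n\<^esub> x))
      = quotient_class n (c \<odot>\<^bsub>free_algebra n\<^esub> p)" (is "(\<Union>x\<in>_. ?f x) = ?rhs")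
  proof (rule equalityI)
    show "(\<Union>x\<in>quotient_class n p. ?f x) \<subseteq> ?rhs"
      by (rule UN_least) (rule equalityD1[OF same])
    show "?rhs \<subseteq> (\<Union>x\<in>quotient_class n p. ?f x)"
      by (rule UN_upper[OF self])
  qed
  thus ?thesis
    by (simp only: periplectic_brauer_def ring.defs module.simps)
qed

lemma ring_End_algebra:
  assumes "vector_space scale"
  shows "ring (End_algebra scale)"
proof -
  interpret vector_space scale by (rule assms)
  interpret vector_space_pair scale scale by unfold_locales
  have neg: "\<exists>g. Vector_Spaces.linear scale scale g \<and> (\<forall>v. f v + g v = 0)"
    if "Vector_Spaces.linear scale scale f" for f
    using linear_compose_neg[OF that] by (intro exI[of _ "\<lambda>v. - f v"]) simp
  have comp: "Vector_Spaces.linear scale scale (f \<circ> g)"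
    if "Vector_Spaces.linear scale scale f" "Vector_Spaces.linear scale scale g" for f g
    using that(2,1) by (rule Vector_Spaces.linear_compose)
  show ?thesis
    by (intro ringI abelian_groupI monoidI)
       (simp_all add: End_algebra_def fun_eq_iff add_ac linear_add neg comp
         linear_compose_add linear_zero linear_id)
qed

end

theory Submission
  imports Defs
begin

text \<open>Let \<open>v\<close> be a joint eigenvector with \<open>Y\<^sub>i v = a v\<close> and \<open>Y\<^sub>i\<^sub>+\<^sub>1 v = c v\<close>. The relation
  \<open>e\<^sub>i (Y\<^sub>i - Y\<^sub>i\<^sub>+\<^sub>1) = - e\<^sub>i\<close> gives \<open>e\<^sub>i v = 0\<close> or \<open>c = a + 1\<close>. If \<open>e\<^sub>i v = 0\<close>, then
  \<open>(Y\<^sub>i\<^sub>+\<^sub>1 - a) s\<^sub>i v = v\<close>. For \<open>c = a\<close> this would be a Jordan block of \<open>Y\<^sub>i\<^sub>+\<^sub>1\<close>, which is excluded.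
  For \<open>c \<noteq> a\<close> the vector \<open>s\<^sub>i v + v / (a - c)\<close> is killed by \<open>Y\<^sub>i - c\<close>. So either \<open>c\<close> is an
  eigenvalue of \<open>Y\<^sub>i\<close>, or \<open>v\<close> is an eigenvector of the involution \<open>s\<^sub>i\<close> and \<open>(a - c)\<^sup>2 = 1\<close>.
  Integrality follows by induction from \<open>Y\<^sub>1 = 0\<close>.\<close>

section \<open>Operator identities for the Jucys-Murphy elements\<close>

locale jucys_murphy_operators = vector_space scale
  for scale :: "complex \<Rightarrow> 'v::ab_group_add \<Rightarrow> 'v" +
  fixes n :: nat and S E Y :: "nat \<Rightarrow> 'v \<Rightarrow> 'v"
  assumes linear_S: "1 \<le> i \<Longrightarrow> i < n \<Longrightarrow> Vector_Spaces.linear scale scale (S i)"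
    and linear_E: "1 \<le> i \<Longrightarrow> i < n \<Longrightarrow> Vector_Spaces.linear scale scale (E i)"
    and linear_Y: "1 \<le> j \<Longrightarrow> j \<le> n \<Longrightarrow> Vector_Spaces.linear scale scale (Y j)"
    and S_S: "1 \<le> i \<Longrightarrow> i < n \<Longrightarrow> S i (S i v) = v"
    and E_S: "1 \<le> i \<Longrightarrow> i < n \<Longrightarrow> E i (S i v) = E i v"
    and S_E: "1 \<le> i \<Longrightarrow> i < n \<Longrightarrow> S i (E i v) = - E i v"
    and E_E: "1 \<le> i \<Longrightarrow> i < n \<Longrightarrow> E i (E i v) = 0"
    and S_S_far: "1 \<le> j \<Longrightarrow> Suc j < i \<Longrightarrow> i < n \<Longrightarrow> S i (S j v) = S j (S i v)"
    and S_E_far: "1 \<le> j \<Longrightarrow> Suc j < i \<Longrightarrow> i < n \<Longrightarrow> S i (E j v) = E j (S i v)"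
    and S_braid: "1 \<le> i \<Longrightarrow> Suc i < n \<Longrightarrow> S i (S (Suc i) (S i v)) = S (Suc i) (S i (S (Suc i) v))"
    and E_E_S: "1 \<le> i \<Longrightarrow> Suc i < n \<Longrightarrow> E (Suc i) (E i (S (Suc i) v)) = E (Suc i) (S i v)"
    and Y_1: "Y 1 v = 0"
    and Y_Suc: "1 \<le> j \<Longrightarrow> j < n \<Longrightarrow> Y (Suc j) v = S j (Y j (S j v)) + S j v + E j v"
begin

lemma
  assumes "1 \<le> i" "i < n"
  shows S_add: "S i (u + v) = S i u + S i v" and E_add: "E i (u + v) = E i u + E i v"
    and S_scale: "S i (scale c v) = scale c (S i v)" and E_scale: "E i (scale c v) = scale c (E i v)"
    and S_0: "S i 0 = 0"
proof -
  interpret S: Vector_Spaces.linear scale scale "S i" by (rule linear_S[OF assms])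
  interpret E: Vector_Spaces.linear scale scale "E i" by (rule linear_E[OF assms])
  show "S i (u + v) = S i u + S i v" "E i (u + v) = E i u + E i v"
    "S i (scale c v) = scale c (S i v)" "E i (scale c v) = scale c (E i v)" "S i 0 = 0"
    by (simp_all add: S.add E.add S.scale E.scale S.zero)
qed

lemma
  assumes "1 \<le> j" "j \<le> n"
  shows Y_add: "Y j (u + v) = Y j u + Y j v" and Y_scale: "Y j (scale c v) = scale c (Y j v)"
proof -
  interpret Y: Vector_Spaces.linear scale scale "Y j" by (rule linear_Y[OF assms])
  show "Y j (u + v) = Y j u + Y j v" "Y j (scale c v) = scale c (Y j v)"
    by (simp_all add: Y.add Y.scale)
qed

text \<open>By the recursion, \<open>Y j\<close> is built from \<open>S k\<close> and
  \<open>E k\<close> with \<open>k < j < i\<close>, and each of these commutes with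
  \<open>S i\<close>.\<close>

lemma S_Y_far:
  assumes "1 \<le> j" "j < i" "i < n"
  shows "S i (Y j v) = Y j (S i v)"
  using assms
proof (induction j arbitrary: v rule: dec_induct)
  case base
  then show ?case using Y_1 by (simp add: S_0)
next
  case (step j)
  then show ?case by (simp add: Y_Suc S_add S_S_far[of j i] S_E_far)
qed

text \<open>This absorption is the core of \<open>E_Y_Suc\<close>. In the induction step the
  recursion splits \<open>E (Suc i) (Y (Suc i) _)\<close> into three terms; precomposing with
  \<open>S (Suc i)\<close> fixes the first and swaps the other two.\<close>

lemma E_Y_S:
  assumes "1 \<le> i" "i < n"
  shows "E i (Y i (S i v)) = E i (Y i v)"
  using assms
proof (induction i arbitrary: v rule: dec_induct)
  case base
  then show ?case using Y_1 by simp
next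
  case (step i)
  have i: "1 \<le> i" "i < n" "Suc i < n" using step by auto
  \<comment> \<open>\<open>E_E_S\<close> creates a factor \<open>S (Suc i)\<close> that slides past
    \<open>Y i\<close>. This leaves \<open>E i\<close> next to \<open>Y i\<close>, and after the
    braid relation the induction hypothesis applies.\<close>
  have move: "E (Suc i) (S i (Y i (S i u))) = E (Suc i) (E i (Y i (S (Suc i) (S i u))))" for u
    using i by (simp add: E_E_S[symmetric] S_Y_far)
  have "E (Suc i) (S i (Y i (S i (S (Suc i) v)))) = E (Suc i) (E i (Y i (S i (S (Suc i) (S i v)))))"
    using i by (simp add: move S_braid)
  also have "\<dots> = E (Suc i) (S i (Y i (S i v)))"
    using i step.IH by (simp add: move)
  finally have head: "E (Suc i) (S i (Y i (S i (S (Suc i) v)))) = E (Suc i) (S i (Y i (S i v)))" .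
  have "E (Suc i) (S i (S (Suc i) v)) = E (Suc i) (E i v)"
    using i by (simp add: E_E_S[symmetric] S_S)
  then show ?case
    using i head by (simp add: Y_Suc E_add E_E_S add_ac)
qed

text \<open>Applying \<open>E i\<close> to the recursion, \<open>E_S\<close> removes the outer
  \<open>S i\<close>, \<open>E_E\<close> kills the last term, and \<open>E_Y_S\<close> absorbs the
  inner \<open>S i\<close>.\<close>

lemma E_Y_Suc:
  assumes "1 \<le> i" "i < n"
  shows "E i (Y (Suc i) v) = E i (Y i v) + E i v"
  using assms by (simp add: Y_Suc E_add E_S E_E E_Y_S)

lemma Y_Suc_S:
  assumes "1 \<le> i" "i < n"
  shows "Y (Suc i) (S i v) = S i (Y i v) + v + E i v"
  using assms by (simp add: Y_Suc S_S E_S)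

text \<open>Here \<open>S i\<close> hits the recursion from the left, so the \<open>E i\<close> term
  picks up its sign from \<open>S_E\<close>; in \<open>Y_Suc_S\<close> it acts from the
  right.\<close>

lemma Y_S:
  assumes "1 \<le> i" "i < n"
  shows "Y i (S i v) = S i (Y (Suc i) v) - v + E i v"
  using assms by (simp add: Y_Suc S_add S_S S_E)

text \<open>Induction step for integrality: \<open>a\<close> is an eigenvalue of \<open>Y i\<close>
  through \<open>v\<close>, so each alternative ties \<open>c\<close> to the spectrum of
  \<open>Y i\<close>.\<close>

lemma eigenvalue_step:
  assumes i: "1 \<le> i" "i < n" and "v \<noteq> 0"
    and a: "Y i v = scale a v" and c: "Y (Suc i) v = scale c v" and "c \<noteq> a"
  shows "c = a + 1 \<or> c = a - 1 \<or> eigenvalue scale (Y i) c"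
proof (cases "E i v = 0")
  case False
  have "scale c (E i v) = scale (a + 1) (E i v)"
    using E_Y_Suc[OF i, of v] i by (simp add: a c E_scale scale_left_distrib)
  then show ?thesis using False by (simp only: scale_cancel_right) simp
next
  case True
  \<comment> \<open>On the span of \<open>S i v\<close> and \<open>v\<close> the operator
    \<open>Y i\<close> is triangular: \<open>S i v\<close> goes to \<open>c\<close> times itself
    minus \<open>v\<close>. The value of \<open>r\<close> is the one making
    \<open>S i v + r v\<close> an eigenvector for \<open>c\<close>.\<close>
  define r where "r = 1 / (a - c)"
  have r: "r * (a - c) = 1" using \<open>c \<noteq> a\<close> by (simp add: r_def)
  define u where "u = S i v + scale r v"
  have "Y i u = scale c (S i v) - v + scale (r * a) v"
    using i True by (simp add: u_def Y_add Y_scale Y_S a c S_scale)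
  also have "r * a = r * c + 1" using r by (simp add: algebra_simps)
  finally have u: "Y i u = scale c u"
    by (simp add: u_def scale_left_distrib scale_right_distrib mult.commute)
  show ?thesis
  proof (cases "u = 0")
    case False
    then show ?thesis using u by (auto simp: eigenvalue_def)
  next
    case True
    then have "S i v = scale (- r) v" by (simp add: u_def eq_neg_iff_add_eq_0)
    then have "S i (S i v) = scale (- r) (scale (- r) v)" by (simp only: S_scale[OF i])
    then have "scale (r * r) v = scale 1 v" by (simp add: S_S[OF i])
    then have "r * r = 1" using \<open>v \<noteq> 0\<close> by (simp only: scale_cancel_right) simp
    then have "r = 1 \<or> r = - 1" by (simp add: square_eq_1_iff)
    then show ?thesis using r by (auto simp: algebra_simps)
  qed
qed

end

section \<open>Coordinates in an eigenbasis\<close>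

text \<open>Both sides are linear in \<open>v\<close>, so induction over the span reduces the claim
  to basis vectors.\<close>

lemma (in vector_space) representation_eigenbasis:
  assumes f: "Vector_Spaces.linear scale scale f"
    and D: "independent D" "span D = UNIV"
    and eigen: "\<And>d. d \<in> D \<Longrightarrow> f d = scale (a d) d"
    and "d \<in> D"
  shows "representation D (f v) d = a d * representation D v d"
proof -
  interpret f: Vector_Spaces.linear scale scale f by (rule f)
  have "v \<in> span D" using D by simp
  then show ?thesis
  proof (induction rule: span_induct_alt)
    case base
    then show ?case by (simp add: f.zero representation_zero)
  next
    case (step c x y)
    then show ?case
      using D \<open>d \<in> D\<close>
      by (auto simp: f.add f.scale eigen representation_add representation_scale representation_basis
          algebra_simps)
  qed
qed

text \<open>An eigenvector has a nonzero coordinate at some \<open>d\<close>; comparing that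
  coordinate in \<open>f v = scale c v\<close> gives \<open>a d = c\<close>.\<close>

lemma (in vector_space) eigenvalue_eigenbasis:
  assumes f: "Vector_Spaces.linear scale scale f"
    and D: "independent D" "span D = UNIV"
    and eigen: "\<And>d. d \<in> D \<Longrightarrow> f d = scale (a d) d"
    and "eigenvalue scale f c"
  shows "\<exists>d\<in>D. a d = c"
proof -
  obtain v where v: "v \<noteq> 0" "f v = scale c v" using assms(5) by (auto simp: eigenvalue_def)
  obtain d where d: "representation D v d \<noteq> 0"
    using v(1) sum_nonzero_representation_eq[OF D(1), of v] D(2) by fastforce
  then have "d \<in> D" by (rule representation_ne_zero)
  have "c * representation D v d = a d * representation D v d"
    using representation_eigenbasis[OF f D eigen \<open>d \<in> D\<close>, of v] D
    by (simp add: v(2) representation_scale)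
  then have "a d = c" using d by simp
  then show ?thesis using \<open>d \<in> D\<close> by blast
qed

section \<open>Joint spectrum on a common eigenbasis\<close>

context jucys_murphy_operators
begin

context
  fixes D :: "'v set" and a :: "nat \<Rightarrow> 'v \<Rightarrow> complex"
  assumes D: "independent D" "span D = UNIV"
    and eigen: "\<And>j d. 1 \<le> j \<Longrightarrow> j \<le> n \<Longrightarrow> d \<in> D \<Longrightarrow> Y j d = scale (a j d) d"
begin

text \<open>Equality would force \<open>E i d = 0\<close> by \<open>E_Y_Suc\<close>. The Jordan
  block is then refuted by computing the \<open>d\<close>-coordinate of
  \<open>Y (Suc i) (S i d)\<close> in two ways, which differ by 1.\<close>

lemma consecutive_eigenvalues_neq:
  assumes i: "1 \<le> i" "i < n" and d: "d \<in> D"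
  shows "a i d \<noteq> a (Suc i) d"
proof
  assume eq: "a i d = a (Suc i) d"
  have "E i d = 0"
    using E_Y_Suc[OF i, of d] eigen[of i d] eigen[of "Suc i" d] i d eq by simp
  then have "Y (Suc i) (S i d) = scale (a i d) (S i d) + d"
    using i d by (simp add: Y_Suc_S eigen S_scale)
  then have "representation D (Y (Suc i) (S i d)) d = a i d * representation D (S i d) d + 1"
    using D d by (simp add: representation_add representation_scale representation_basis)
  moreover have "representation D (Y (Suc i) (S i d)) d = a (Suc i) d * representation D (S i d) d"
    using i by (intro representation_eigenbasis linear_Y D eigen d) auto
  ultimately show False using eq by simp
qed

lemma eigenvalue_Y_Ints:
  assumes "1 \<le> j" "j \<le> n" "eigenvalue scale (Y j) c"
  shows "c \<in> \<int>"
  using assms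
proof (induction j arbitrary: c rule: dec_induct)
  case base
  then show ?case using Y_1 by (auto simp: eigenvalue_def)
next
  case (step i)
  have i: "1 \<le> i" "i < n" using step by auto
  \<comment> \<open>An arbitrary eigenvector of \<open>Y (Suc i)\<close> may fail to be one for
    \<open>Y i\<close>, so it is replaced by a joint eigenvector from \<open>D\<close> with the same
    eigenvalue.\<close>
  obtain d where d: "d \<in> D" "a (Suc i) d = c"
    using eigenvalue_eigenbasis[OF linear_Y D eigen] step by fastforce
  have "d \<noteq> 0" using d D dependent_zero by blast
  have Yi: "Y i d = scale (a i d) d" using eigen d i by simp
  then have "a i d \<in> \<int>" using step i \<open>d \<noteq> 0\<close> by (auto simp: eigenvalue_def)
  moreover have "c = a i d + 1 \<or> c = a i d - 1 \<or> eigenvalue scale (Y i) c"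
    using eigenvalue_step[OF i \<open>d \<noteq> 0\<close> Yi] eigen[of "Suc i" d] i d
      consecutive_eigenvalues_neq[OF i d(1)] by auto
  ultimately show ?case using step i by auto
qed

end

end

section \<open>From algebra representations to operators\<close>

lemma periplectic_brauer_simps:
  "carrier (periplectic_brauer n) = carrier (free_algebra n Quot relation_ideal n)"
  "monoid.mult (periplectic_brauer n) = monoid.mult (free_algebra n Quot relation_ideal n)"
  "one (periplectic_brauer n) = one (free_algebra n Quot relation_ideal n)"
  "zero (periplectic_brauer n) = zero (free_algebra n Quot relation_ideal n)"
  "add (periplectic_brauer n) = add (free_algebra n Quot relation_ideal n)"
  by (simp_all add: periplectic_brauer_def ring.defs)

lemma quotient_class_hom: "quotient_class n \<in> ring_hom (free_algebra n) (periplectic_brauer n)"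
  using ideal.rcos_ring_hom[OF ideal_relation_ideal]
  by (simp add: ring_hom_def periplectic_brauer_simps quotient_class_def[abs_def])

lemma s_elem_closed: "1 \<le> i \<Longrightarrow> i < n \<Longrightarrow> s_elem n i \<in> carrier (periplectic_brauer n)"
  and e_elem_closed: "1 \<le> i \<Longrightarrow> i < n \<Longrightarrow> e_elem n i \<in> carrier (periplectic_brauer n)"
  unfolding s_elem_def e_elem_def
  by (auto intro!: ring_hom_closed[OF quotient_class_hom] gens_closed)

lemma jucys_murphy_closed:
  assumes "1 \<le> j" "j \<le> n"
  shows "jucys_murphy n j \<in> carrier (periplectic_brauer n)"
proof -
  interpret ring "periplectic_brauer n" by (rule ring_periplectic_brauer)
  from assms show ?thesis
  proof (induction j rule: dec_induct)
    case base
    then show ?case by simp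
  next
    case (step j)
    \<comment> \<open>The recursive equation of \<open>jucys_murphy\<close> matches only on
      \<open>Suc (Suc k)\<close>.\<close>
    then obtain k where "j = Suc k" by (cases j) auto
    then show ?case using step by (simp add: s_elem_closed e_elem_closed)
  qed
qed

lemma representation_of_operators:
  assumes "vector_space scale" and rep: "representation_of n scale \<rho>"
  shows "jucys_murphy_operators scale n (\<lambda>i. \<rho> (s_elem n i)) (\<lambda>i. \<rho> (e_elem n i))
    (\<lambda>j. \<rho> (jucys_murphy n j))"
proof -
  interpret V: vector_space scale by (rule assms)
  interpret A: ring "periplectic_brauer n" by (rule ring_periplectic_brauer)
  have hom: "\<rho> \<in> ring_hom (periplectic_brauer n) (End_algebra scale)"
    using rep by (simp add: representation_of_def algebra_hom_def)
  have lin: "Vector_Spaces.linear scale scale (\<rho> x)" if "x \<in> carrier (periplectic_brauer n)" for x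
    using ring_hom_closed[OF hom that] by (simp add: End_algebra_def)
  have mult: "\<rho> (x \<otimes>\<^bsub>periplectic_brauer n\<^esub> y) v = \<rho> x (\<rho> y v)"
    if "x \<in> carrier (periplectic_brauer n)" "y \<in> carrier (periplectic_brauer n)" for x y v
    using ring_hom_mult[OF hom that] by (simp add: End_algebra_def)
  have add: "\<rho> (x \<oplus>\<^bsub>periplectic_brauer n\<^esub> y) v = \<rho> x v + \<rho> y v"
    if "x \<in> carrier (periplectic_brauer n)" "y \<in> carrier (periplectic_brauer n)" for x y v
    using ring_hom_add[OF hom that] by (simp add: End_algebra_def)
  \<comment> \<open>Membership in \<open>ring_hom\<close> does not state preservation of zero; it
    follows from additivity at 0 + 0.\<close>
  have zero: "\<rho> \<zero>\<^bsub>periplectic_brauer n\<^esub> v = 0" for v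
    using add[of "\<zero>\<^bsub>periplectic_brauer n\<^esub>" "\<zero>\<^bsub>periplectic_brauer n\<^esub>" v] by simp

  \<comment> \<open>Pulling \<open>\<rho>\<close> back to the free algebra turns each defining
    relation into an identity of composed operators.\<close>
  define \<phi> where "\<phi> p = \<rho> (quotient_class n p)" for p
  have cl: "quotient_class n p \<in> carrier (periplectic_brauer n)" if "p \<in> carrier (free_algebra n)" for p
    by (rule ring_hom_closed[OF quotient_class_hom that])
  have \<phi>_mult: "\<phi> (p * q) v = \<phi> p (\<phi> q v)"
    if "p \<in> carrier (free_algebra n)" "q \<in> carrier (free_algebra n)" for p q v
    using ring_hom_mult[OF quotient_class_hom that] that by (simp add: \<phi>_def mult cl)
  have \<phi>_add: "\<phi> (p + q) v = \<phi> p v + \<phi> q v"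
    if "p \<in> carrier (free_algebra n)" "q \<in> carrier (free_algebra n)" for p q v
    using ring_hom_add[OF quotient_class_hom that] that by (simp add: \<phi>_def add cl)
  have \<phi>_1: "\<phi> 1 v = v" for v
    using ring_hom_one[OF quotient_class_hom] ring_hom_one[OF hom]
    by (simp add: \<phi>_def End_algebra_def)
  have \<phi>_0: "\<phi> 0 v = 0" for v
    using \<phi>_add[of 0 0 v] by (simp add: free_algebra_zero_one)
  have \<phi>_minus: "\<phi> (- p) v = - \<phi> p v" if "p \<in> carrier (free_algebra n)" for p v
    using \<phi>_add[OF free_algebra_closed(3)[OF that that] that, of v]
    by (simp add: \<phi>_0 eq_neg_iff_add_eq_0)
  have rel: "\<phi> p v = \<phi> q v" if "defining_relation n p q" for p q v
    by (simp add: \<phi>_def quotient_class_relation[OF that])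
  have S: "\<rho> (s_elem n i) = \<phi> (s_gen i)" and E: "\<rho> (e_elem n i) = \<phi> (e_gen i)" for i
    by (simp_all add: \<phi>_def s_elem_def e_elem_def)
  note simps = S E \<phi>_mult \<phi>_1 \<phi>_0 \<phi>_minus gens_closed free_algebra_closed
  show ?thesis
  proof (rule jucys_murphy_operators.intro[OF assms(1)], rule jucys_murphy_operators_axioms.intro)
    fix i v assume i: "1 \<le> i" "i < n"
    show "Vector_Spaces.linear scale scale (\<rho> (s_elem n i))"
      "Vector_Spaces.linear scale scale (\<rho> (e_elem n i))"
      using i by (auto intro!: lin s_elem_closed e_elem_closed)
    show "\<rho> (s_elem n i) (\<rho> (s_elem n i) v) = v"
      using rel[OF defining_relation.s_square[of i n], of v] i by (simp add: simps)
    show "\<rho> (e_elem n i) (\<rho> (s_elem n i) v) = \<rho> (e_elem n i) v"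
      using rel[OF defining_relation.es[of i n], of v] i by (simp add: simps)
    show "\<rho> (s_elem n i) (\<rho> (e_elem n i) v) = - \<rho> (e_elem n i) v"
      using rel[OF defining_relation.se[of i n], of v] i by (simp add: simps)
    show "\<rho> (e_elem n i) (\<rho> (e_elem n i) v) = 0"
      using rel[OF defining_relation.e_square[of i n], of v] i by (simp add: simps)
    obtain k where k: "i = Suc k" using i by (cases i) auto
    show "\<rho> (jucys_murphy n (Suc i)) v
      = \<rho> (s_elem n i) (\<rho> (jucys_murphy n i) (\<rho> (s_elem n i) v)) + \<rho> (s_elem n i) v + \<rho> (e_elem n i) v"
      using i jucys_murphy_closed[of i n] s_elem_closed[of i n] e_elem_closed[of i n]
      by (simp add: k mult add)
  next
    fix i v assume i: "1 \<le> i" "Suc i < n"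
    show "\<rho> (s_elem n i) (\<rho> (s_elem n (Suc i)) (\<rho> (s_elem n i) v))
      = \<rho> (s_elem n (Suc i)) (\<rho> (s_elem n i) (\<rho> (s_elem n (Suc i)) v))"
      using rel[OF defining_relation.braid[of i n], of v] i by (simp add: simps)
    show "\<rho> (e_elem n (Suc i)) (\<rho> (e_elem n i) (\<rho> (s_elem n (Suc i)) v))
      = \<rho> (e_elem n (Suc i)) (\<rho> (s_elem n i) v)"
      using rel[OF defining_relation.ees_up[of i n], of v] i by (simp add: simps)
  next
    fix i j v assume ij: "1 \<le> j" "Suc j < i" "i < n"
    show "\<rho> (s_elem n i) (\<rho> (s_elem n j) v) = \<rho> (s_elem n j) (\<rho> (s_elem n i) v)"
      using rel[OF defining_relation.ss_commute[of i n j], of v] ij by (simp add: simps)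
    show "\<rho> (s_elem n i) (\<rho> (e_elem n j) v) = \<rho> (e_elem n j) (\<rho> (s_elem n i) v)"
      using rel[OF defining_relation.se_commute[of i n j], of v] ij by (simp add: simps)
  next
    fix j assume "1 \<le> j" "j \<le> n"
    then show "Vector_Spaces.linear scale scale (\<rho> (jucys_murphy n j))"
      by (intro lin jucys_murphy_closed)
  next
    fix v show "\<rho> (jucys_murphy n 1) v = 0" by (simp add: zero)
  qed
qed

section \<open>From diagonal matrices to eigenvectors, and conclusion\<close>

lemma diagonal_wrt_basis:
  assumes "vector_space scale" "ordered_basis scale b" "diagonal_wrt scale b f"
    and l: "l \<in> {1..vdim scale}"
  shows "f (b l) = scale (matrix_entry scale b f l l) (b l)"
proof -
  interpret vector_space scale by (rule assms)
  let ?D = "b ` {1..vdim scale}"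
  have D: "independent ?D" "span ?D = UNIV" using assms(2) by (auto simp: ordered_basis_def)
  have "f (b l) = (\<Sum>d\<in>?D. scale (representation ?D (f (b l)) d) d)"
    using D by (intro sum_representation_eq[symmetric]) auto
  also have "\<dots> = (\<Sum>d\<in>{b l}. scale (representation ?D (f (b l)) d) d)"
  proof (rule sum.mono_neutral_right)
    show "\<forall>d\<in>?D - {b l}. scale (representation ?D (f (b l)) d) d = 0"
    proof
      fix d assume "d \<in> ?D - {b l}"
      then obtain k where "k \<in> {1..vdim scale}" "d = b k" "k \<noteq> l" by blast
      then show "scale (representation ?D (f (b l)) d) d = 0"
        using l assms(3) unfolding diagonal_wrt_def matrix_entry_def by simp
    qed
  qed (use l in auto)
  finally show ?thesis by (simp add: matrix_entry_def)
qed

theorem corollary30: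
  fixes scale :: "complex \<Rightarrow> 'v::ab_group_add \<Rightarrow> 'v"
    and B :: "'v set"
    and \<rho> :: "nc_poly set \<Rightarrow> 'v \<Rightarrow> 'v"
    and n :: nat
  assumes "n \<ge> 2"
    and "finite_dimensional_vector_space scale B"
    and "representation_of n scale \<rho>"
    and "calibrated n scale \<rho>"
  shows "(\<forall>j\<in>{2..n}. \<forall>c. eigenvalue scale (\<rho> (jucys_murphy n j)) c \<longrightarrow> c \<in> \<int>)
    \<and> (\<forall>b. diagonalizing_basis n scale \<rho> b \<longrightarrow>
         (\<forall>l\<in>{1..vdim scale}. \<forall>j\<in>{1..n-1}.
            matrix_entry scale b (\<rho> (jucys_murphy n j)) l l
              \<noteq> matrix_entry scale b (\<rho> (jucys_murphy n (j+1))) l l))"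
proof -
  interpret finite_dimensional_vector_space scale B by (rule assms)
  interpret jucys_murphy_operators scale n "\<lambda>i. \<rho> (s_elem n i)" "\<lambda>i. \<rho> (e_elem n i)"
    "\<lambda>j. \<rho> (jucys_murphy n j)"
    by (intro representation_of_operators vector_space_axioms assms)
  \<comment> \<open>The eigenbasis results index eigenvalues by vectors; \<open>inv_into\<close>
    recovers the position of \<open>d\<close> in the ordered basis.\<close>
  define a where "a b j d = matrix_entry scale b (\<rho> (jucys_murphy n j))
    (inv_into {1..vdim scale} b d) (inv_into {1..vdim scale} b d)" for b j d
  have eigenbasis: "independent (b ` {1..vdim scale})" "span (b ` {1..vdim scale}) = UNIV"
    "\<And>j d. 1 \<le> j \<Longrightarrow> j \<le> n \<Longrightarrow> d \<in> b ` {1..vdim scale} \<Longrightarrow>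
      \<rho> (jucys_murphy n j) d = scale (a b j d) d"
    if b: "diagonalizing_basis n scale \<rho> b" for b
  proof -
    have ob: "ordered_basis scale b" using b by (simp add: diagonalizing_basis_def)
    then show "independent (b ` {1..vdim scale})" "span (b ` {1..vdim scale}) = UNIV"
      by (simp_all add: ordered_basis_def)
    fix j d assume j: "1 \<le> j" "j \<le> n" and d: "d \<in> b ` {1..vdim scale}"
    have "diagonal_wrt scale b (\<rho> (jucys_murphy n j))"
      using b j by (simp add: diagonalizing_basis_def)
    from diagonal_wrt_basis[OF vector_space_axioms ob this inv_into_into[OF d]]
    show "\<rho> (jucys_murphy n j) d = scale (a b j d) d"
      by (simp only: a_def f_inv_into_f[OF d])
  qed
  show ?thesis
  proof (intro conjI ballI allI impI)
    fix j c assume "j \<in> {2..n}" "eigenvalue scale (\<rho> (jucys_murphy n j)) c"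
    moreover obtain b where b: "diagonalizing_basis n scale \<rho> b"
      using assms(4) by (auto simp: calibrated_def)
    ultimately show "c \<in> \<int>"
      using eigenvalue_Y_Ints[OF eigenbasis[OF b], of j c] by simp
  next
    fix b l j
    assume b: "diagonalizing_basis n scale \<rho> b" and l: "l \<in> {1..vdim scale}" and j: "j \<in> {1..n-1}"
    have "j < n" using j assms(1) by auto
    \<comment> \<open>Injectivity of the ordered basis identifies \<open>a b j (b l)\<close> with
      the diagonal entry at \<open>l\<close>.\<close>
    moreover have "inv_into {1..vdim scale} b (b l) = l"
      using b l by (simp add: diagonalizing_basis_def ordered_basis_def)
    ultimately show "matrix_entry scale b (\<rho> (jucys_murphy n j)) l l
      \<noteq> matrix_entry scale b (\<rho> (jucys_murphy n (j+1))) l l"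
      using consecutive_eigenvalues_neq[OF eigenbasis[OF b], of j "b l"] j l
      by (simp add: a_def)
  qed
qed

end
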